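(* Let $N\ge1$ and let $\boldsymbol{\xi}$ be a random subset of $\{1,\dots,N\}$ distributed according to a non-trivial product distribution with $0<\beta\le\min\{p_k,1-p_k\}$ for all $k$. Then for any $\kappa\in(0,1]$ and any $\kappa$-Sperner family $\mathcal{A}\subset2^{\{1,\dots,N\}}$, $$\sum_{0\le k\le N}\mathbb{P}\big[\boldsymbol{\xi}\in\mathcal{A}\,\big|\,|\boldsymbol{\xi}|=k\big]\ \le\ \frac{(1-\beta)^2}{\beta^2\kappa}.$$
   Context: Subsets $\boldsymbol{\xi}\subset\{1,\dots,N\}$ are identified with vectors $(\xi_1,\dots,\xi_N)\in\{0,1\}^N$ via $\xi_k=1$ iff $k\in\boldsymbol{\xi}$; $|\boldsymbol{\xi}|$ is the cardinality. A probability measure on $2^{\{1,\dots,N\}}$ is a product distribution if the coordinates $\xi_k$ are independent; it is non-trivial if $p_k:=\mathbb{P}[\xi_k=1]\in(0,1)$ for all $k$. $\mathcal{A}\subset2^{\{1,\dots,N\}}$ is a $\kappa$-Sperner family ($\kappa\in(0,1]$) if for every $\boldsymbol{\eta}\in\mathcal{A}$ there is $B(\boldsymbol{\eta})\subset\boldsymbol{\eta}^c$ with $|B(\boldsymbol{\eta})|\ge\kappa|\boldsymbol{\eta}^c|$ such that for any $\boldsymbol{\eta}'\in\mathcal{A}$, $\boldsymbol{\eta}'\supset\boldsymbol{\eta}$ implies $\boldsymbol{\eta}'\cap B(\boldsymbol{\eta})=\varnothing$. *)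

theory Defs
  imports "HOL-Probability.Probability"
begin

definition product_distribution :: "nat \<Rightarrow> nat set measure \<Rightarrow> bool" where
  "product_distribution N \<mu> \<longleftrightarrow>
     prob_space \<mu> \<and> space \<mu> = Pow {1..N} \<and> sets \<mu> = Pow (Pow {1..N}) \<and>
     prob_space.indep_vars \<mu> (\<lambda>_. count_space UNIV) (\<lambda>k S. k \<in> S) {1..N}"

definition marginal :: "nat set measure \<Rightarrow> nat \<Rightarrow> real" where
  "marginal \<mu> k = \<P>(S in \<mu>. k \<in> S)"

definition nontrivial_product_distribution :: "nat \<Rightarrow> nat set measure \<Rightarrow> bool" where
  "nontrivial_product_distribution N \<mu> \<longleftrightarrow>
     product_distribution N \<mu> \<and> (\<forall>k\<in>{1..N}. 0 < marginal \<mu> k \<and> marginal \<mu> k < 1)"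

text \<open>Complements are taken in \<open>{1..N}\<close>.  The inclusion \<open>\<eta> \<subseteq> \<eta>'\<close> need not be strict: the case
  \<open>\<eta>' = \<eta>\<close> asks nothing new because \<open>B\<close> lies in the complement of \<open>\<eta>\<close>.\<close>

definition Sperner_family :: "nat \<Rightarrow> real \<Rightarrow> nat set set \<Rightarrow> bool" where
  "Sperner_family N \<kappa> \<A> \<longleftrightarrow>
     \<A> \<subseteq> Pow {1..N} \<and>
     (\<forall>\<eta>\<in>\<A>. \<exists>B. B \<subseteq> {1..N} - \<eta> \<and> real (card B) \<ge> \<kappa> * real (card ({1..N} - \<eta>)) \<and>
        (\<forall>\<eta>'\<in>\<A>. \<eta> \<subseteq> \<eta>' \<longrightarrow> \<eta>' \<inter> B = {}))"

end

theory Submission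
  imports Defs
begin

text \<open>
  Conditioned on \<open>|\<xi>| = k\<close>, the set \<open>\<xi>\<close> has the law \<open>\<mu>\<^sub>k(S) \<propto> \<Prod>i\<in>S. r\<^sub>i\<close> with \<open>r\<^sub>i = p\<^sub>i / (1 - p\<^sub>i)\<close>.
  These laws are the marginals of one increasing Markov chain: from \<open>\<eta>\<close> with \<open>|\<eta>| = k\<close>, draw \<open>\<zeta>\<close>
  from \<open>\<mu>\<^sub>k\<^sub>+\<^sub>1\<close> and add to \<open>\<eta>\<close> a uniformly chosen element of \<open>\<zeta> - \<eta>\<close>.  Since the ratios
  \<open>r\<^sub>i / r\<^sub>j\<close> are at most \<open>1/c\<close> with \<open>c = \<beta>\<^sup>2 / (1 - \<beta>)\<^sup>2\<close>, each element of the complement of \<open>\<eta>\<close> is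
  added with probability at least \<open>c / |\<eta>\<^sup>c|\<close>.  Thus, whenever the chain is in the Sperner family, its
  next step enters \<open>B(\<eta>)\<close>, after which it never returns to the family, with probability at
  least \<open>\<kappa> c\<close>.  The expected number of visits, which is the sum to be bounded, is therefore at
  most \<open>1 / (\<kappa> c)\<close>.
\<close>

section \<open>Weighted laws on the layers and the increasing chain between them\<close>

locale weighted_subsets =
  fixes U :: "'a set" and r :: "'a \<Rightarrow> real"
  assumes finite_U [simp]: "finite U" and r_pos: "\<And>i. i \<in> U \<Longrightarrow> 0 < r i"
begin

definition layer :: "nat \<Rightarrow> 'a set set" where
  "layer k = {S. S \<subseteq> U \<and> card S = k}"

text \<open>The elementary symmetric polynomial of degree \<open>k\<close> in the weights
  \<open>r\<close>.\<close>

definition layer_weight :: "nat \<Rightarrow> real" where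
  "layer_weight k = (\<Sum>S\<in>layer k. prod r S)"

definition layer_law :: "'a set \<Rightarrow> real" where
  "layer_law S = prod r S / layer_weight (card S)"

text \<open>For \<open>j\<close> in \<open>U - \<eta>\<close>, the transition probability from
  \<open>\<eta>\<close> to \<open>insert j \<eta>\<close>, with the auxiliary set
  \<open>\<zeta>\<close> summed out.\<close>

definition step :: "'a set \<Rightarrow> 'a \<Rightarrow> real" where
  "step \<eta> j = (\<Sum>\<zeta>\<in>{\<zeta>\<in>layer (Suc (card \<eta>)). j \<in> \<zeta>}. layer_law \<zeta> / card (\<zeta> - \<eta>))"

text \<open>Expected number of visits to \<open>\<A>\<close> among the first \<open>n\<close> states
  of the chain started at \<open>\<eta>\<close>, the start included. Conditioning on the first step
  avoids a path space.\<close>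

primrec visits :: "'a set set \<Rightarrow> nat \<Rightarrow> 'a set \<Rightarrow> real" where
  "visits \<A> 0 \<eta> = 0"
| "visits \<A> (Suc n) \<eta> =
     indicator \<A> \<eta> + (\<Sum>j\<in>U - \<eta>. step \<eta> j * visits \<A> n (insert j \<eta>))"

lemma finite_layer [simp]: "finite (layer k)"
  unfolding layer_def by (rule finite_subset[of _ "Pow U"]) auto

lemma layerD: "S \<in> layer k \<Longrightarrow> S \<subseteq> U" "S \<in> layer k \<Longrightarrow> card S = k" "S \<in> layer k \<Longrightarrow> finite S"
  by (auto simp: layer_def intro: finite_subset)

lemma prod_r_pos: "S \<subseteq> U \<Longrightarrow> 0 < prod r S"
  using r_pos by (intro prod_pos) auto

lemma layer_weight_pos:
  assumes "k \<le> card U"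
  shows "0 < layer_weight k"
proof -
  obtain S where "S \<subseteq> U" "card S = k"
    using obtain_subset_with_card_n[OF assms] by metis
  then show ?thesis
    unfolding layer_weight_def
    by (intro sum_pos) (auto simp: layer_def intro: prod_r_pos)
qed

lemma layer_law_nonneg: "S \<subseteq> U \<Longrightarrow> 0 \<le> layer_law S"
  unfolding layer_law_def layer_weight_def
  by (intro divide_nonneg_nonneg sum_nonneg less_imp_le[OF prod_r_pos]) (auto simp: layer_def)

lemma sum_layer_law:
  assumes "k \<le> card U"
  shows "(\<Sum>S\<in>layer k. layer_law S) = 1"
proof -
  have "(\<Sum>S\<in>layer k. layer_law S) = (\<Sum>S\<in>layer k. prod r S / layer_weight k)"
    by (intro sum.cong) (auto simp: layer_law_def layer_def)
  also have "\<dots> = 1"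
    using layer_weight_pos[OF assms]
    by (simp add: sum_divide_distrib[symmetric] layer_weight_def[symmetric])
  finally show ?thesis .
qed

lemma step_nonneg: "0 \<le> step \<eta> j"
  unfolding step_def by (intro sum_nonneg divide_nonneg_nonneg layer_law_nonneg) (auto dest: layerD)

lemma card_Diff_layer_pos:
  assumes "\<eta> \<in> layer k" "\<zeta> \<in> layer (Suc k)"
  shows "0 < card (\<zeta> - \<eta>)"
proof -
  have "\<not> \<zeta> \<subseteq> \<eta>"
    using card_mono[of \<eta> \<zeta>] layerD[OF assms(1)] layerD[OF assms(2)] by auto
  then show ?thesis
    using layerD(3)[OF assms(2)] by (auto simp: card_gt_0_iff)
qed

lemma sum_step_swap:
  assumes "\<eta> \<in> layer k"
  shows "(\<Sum>j\<in>U - \<eta>. step \<eta> j * g j) =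
    (\<Sum>\<zeta>\<in>layer (Suc k). \<Sum>j\<in>\<zeta> - \<eta>. layer_law \<zeta> / card (\<zeta> - \<eta>) * g j)"
proof -
  have "(\<Sum>j\<in>U - \<eta>. step \<eta> j * g j) =
    (\<Sum>j\<in>U - \<eta>. \<Sum>\<zeta> | \<zeta> \<in> layer (Suc k) \<and> j \<in> \<zeta>. layer_law \<zeta> / card (\<zeta> - \<eta>) * g j)"
    using layerD(2)[OF assms] by (simp add: step_def sum_distrib_right)
  also have "\<dots> = (\<Sum>\<zeta>\<in>layer (Suc k). \<Sum>j | j \<in> U - \<eta> \<and> j \<in> \<zeta>. layer_law \<zeta> / card (\<zeta> - \<eta>) * g j)"
    by (rule sum.swap_restrict) auto
  also have "\<dots> = (\<Sum>\<zeta>\<in>layer (Suc k). \<Sum>j\<in>\<zeta> - \<eta>. layer_law \<zeta> / card (\<zeta> - \<eta>) * g j)"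
    by (intro sum.cong) (auto dest: layerD)
  finally show ?thesis .
qed

text \<open>For each \<open>\<zeta>\<close> the uniform choice from \<open>\<zeta> - \<eta>\<close>
  has total mass 1, and so has the law of \<open>\<zeta>\<close>. From \<open>\<eta> = U\<close> no
  step is possible.\<close>

lemma sum_step:
  assumes "\<eta> \<subset> U"
  shows "(\<Sum>j\<in>U - \<eta>. step \<eta> j) = 1"
proof -
  have eta: "\<eta> \<in> layer (card \<eta>)"
    using assms by (auto simp: layer_def)
  have "(\<Sum>j\<in>U - \<eta>. step \<eta> j) =
      (\<Sum>\<zeta>\<in>layer (Suc (card \<eta>)). \<Sum>j\<in>\<zeta> - \<eta>. layer_law \<zeta> / card (\<zeta> - \<eta>))"
    using sum_step_swap[OF eta, of "\<lambda>_. 1"] by simp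
  also have "\<dots> = (\<Sum>\<zeta>\<in>layer (Suc (card \<eta>)). layer_law \<zeta>)"
    using card_Diff_layer_pos[OF eta] by (intro sum.cong) auto
  also have "\<dots> = 1"
    using psubset_card_mono[OF finite_U assms] by (intro sum_layer_law) simp
  finally show ?thesis .
qed

text \<open>One step carries the law of layer \<open>k\<close> to that of layer
  \<open>Suc k\<close>: for independent \<open>\<eta>\<close>, \<open>\<zeta>\<close> and uniform
  \<open>j\<close> in \<open>\<zeta> - \<eta>\<close>, an exchange symmetry of the triple gives
  \<open>insert j \<eta>\<close> the law of \<open>\<zeta>\<close>.\<close>

lemma sum_layer_step:
  "(\<Sum>\<eta>\<in>layer k. layer_law \<eta> * (\<Sum>j\<in>U - \<eta>. step \<eta> j * g (insert j \<eta>))) =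
   (\<Sum>\<zeta>\<in>layer (Suc k). layer_law \<zeta> * g \<zeta>)"
proof (cases "k < card U")
  \<comment> \<open>From the top layer on, both sides vanish.\<close>
  case False
  have "layer (Suc k) = {}"
  proof (rule equals0I)
    fix S assume "S \<in> layer (Suc k)"
    then show False
      using False card_mono[OF finite_U layerD(1)] layerD(2) by fastforce
  qed
  moreover have "layer k \<subseteq> {U}"
  proof
    fix \<eta> assume \<eta>: "\<eta> \<in> layer k"
    then have "card U \<le> card \<eta>"
      using False layerD(2) by fastforce
    with layerD(1)[OF \<eta>] show "\<eta> \<in> {U}"
      by (simp add: card_seteq)
  qed
  then have "layer k = {} \<or> layer k = {U}"
    by (rule subset_singletonD)
  ultimately show ?thesis by auto
next
  case True
  define X where "X = (SIGMA \<eta>:layer k. SIGMA \<zeta>:layer (Suc k). \<zeta> - \<eta>)"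
  \<comment> \<open>The test value \<open>h\<close> stays a separate argument, so that invariance of
    the joint weight reads \<open>F (\<sigma> x) = F x\<close> whatever \<open>g\<close> is.\<close>
  define F :: "('a set \<times> 'a set \<times> 'a) \<Rightarrow> real \<Rightarrow> real" where
    "F = (\<lambda>(\<eta>, \<zeta>, j) h. layer_law \<eta> * layer_law \<zeta> / card (\<zeta> - \<eta>) * h)"
  \<comment> \<open>\<open>\<sigma>\<close> moves the added element \<open>j\<close> from \<open>\<zeta>\<close> to \<open>\<eta>\<close>; the roles of the two sets are then exchanged, and the
    joint weight and the number \<open>|\<zeta> - \<eta>|\<close> of choices for \<open>j\<close> are unchanged.\<close>
  define \<sigma> where "\<sigma> = (\<lambda>(\<eta>, \<zeta>, j). (\<zeta> - {j}, insert j \<eta>, j) :: 'a set \<times> 'a set \<times> 'a)"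
  have finX: "finite (layer (Suc k))" "\<forall>\<zeta>\<in>layer (Suc k). finite (\<zeta> - \<eta>)" for \<eta>
    by (auto dest: layerD)
  have finY: "\<forall>\<eta>\<in>layer k. finite (SIGMA \<zeta>:layer (Suc k). \<zeta> - \<eta>)"
    using finX by (intro ballI finite_SigmaI) auto
  have \<sigma>: "\<sigma> (\<sigma> x) = x \<and> \<sigma> x \<in> X \<and> fst (snd (\<sigma> x)) = insert (snd (snd x)) (fst x) \<and>
      F (\<sigma> x) = F x" if "x \<in> X" for x
  proof -
    obtain \<eta> \<zeta> j where x: "x = (\<eta>, \<zeta>, j)" "(\<eta>, \<zeta>, j) \<in> X"
      using \<open>x \<in> X\<close> by (metis prod_cases3)
    then have mem: "\<eta> \<in> layer k" "\<zeta> \<in> layer (Suc k)" "j \<in> \<zeta>" "j \<notin> \<eta>"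
      by (auto simp: X_def)
    note fin = layerD(3)[OF mem(1)] layerD(3)[OF mem(2)]
    have eta: "\<eta> \<subseteq> U" "card \<eta> = k" and zeta: "\<zeta> \<subseteq> U" "card \<zeta> = Suc k"
      using mem by (auto dest: layerD)
    have sets: "insert j \<zeta> = \<zeta>" "\<eta> - {j} = \<eta>"
        "insert j \<eta> - (\<zeta> - {j}) = insert j (\<eta> - \<zeta>)"
      using mem by auto
    have X: "(\<zeta> - {j}, insert j \<eta>, j) \<in> X"
      using mem fin by (auto simp: X_def layer_def)
    \<comment> \<open>\<open>\<zeta>\<close> has one element more than \<open>\<eta>\<close>, hence
      \<open>\<zeta> - \<eta>\<close> has one more than \<open>\<eta> - \<zeta>\<close>.\<close>
    have "card (insert j (\<eta> - \<zeta>)) = card (\<zeta> - \<eta>)"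
      using card_Int_Diff[OF fin(1), of \<zeta>] card_Int_Diff[OF fin(2), of \<eta>] eta zeta fin mem
      by (simp add: Int_commute)
    moreover have "prod r \<eta> * prod r \<zeta> = prod r (\<zeta> - {j}) * prod r (insert j \<eta>)"
      using prod.remove[OF fin(2) mem(3), of r] fin mem by simp
    \<comment> \<open>The new sets again have sizes \<open>k\<close> and \<open>Suc k\<close>, so
      the normalising factors agree too.\<close>
    then have "layer_law \<eta> * layer_law \<zeta> = layer_law (\<zeta> - {j}) * layer_law (insert j \<eta>)"
      using fin mem eta zeta by (simp add: layer_law_def)
    ultimately show ?thesis
      using X by (simp add: x(1) \<sigma>_def F_def sets)
  qed
  have "(\<Sum>\<eta>\<in>layer k. layer_law \<eta> * (\<Sum>j\<in>U - \<eta>. step \<eta> j * g (insert j \<eta>))) =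
     (\<Sum>\<eta>\<in>layer k. \<Sum>\<zeta>\<in>layer (Suc k). \<Sum>j\<in>\<zeta> - \<eta>. F (\<eta>, \<zeta>, j) (g (insert j \<eta>)))"
    by (intro sum.cong refl) (simp add: sum_step_swap sum_distrib_left F_def mult.assoc)
  also have "\<dots> = (\<Sum>x\<in>X. F x (g (insert (snd (snd x)) (fst x))))"
    unfolding X_def using finX finY
    by (simp add: sum.Sigma case_prod_unfold)
  also have "\<dots> = (\<Sum>x\<in>X. F x (g (fst (snd x))))"
    by (rule sum.reindex_bij_witness[of _ \<sigma> \<sigma>]) (use \<sigma> in auto)
  also have "\<dots> = (\<Sum>\<eta>\<in>layer k. \<Sum>\<zeta>\<in>layer (Suc k). \<Sum>j\<in>\<zeta> - \<eta>. F (\<eta>, \<zeta>, j) (g \<zeta>))"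
    unfolding X_def using finX finY
    by (simp add: sum.Sigma case_prod_unfold)
  \<comment> \<open>The summand is now free of \<open>j\<close>, so summing over
    \<open>\<zeta> - \<eta>\<close> cancels the denominator.\<close>
  also have "\<dots> = (\<Sum>\<eta>\<in>layer k. \<Sum>\<zeta>\<in>layer (Suc k). layer_law \<eta> * (layer_law \<zeta> * g \<zeta>))"
    using card_Diff_layer_pos by (intro sum.cong refl) (auto simp: F_def)
  also have "\<dots> = (\<Sum>\<eta>\<in>layer k. layer_law \<eta>) * (\<Sum>\<zeta>\<in>layer (Suc k). layer_law \<zeta> * g \<zeta>)"
    by (simp add: sum_product)
  also have "\<dots> = (\<Sum>\<zeta>\<in>layer (Suc k). layer_law \<zeta> * g \<zeta>)"
    using True by (simp add: sum_layer_law)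
  finally show ?thesis .
qed

section \<open>Expected numbers of visits\<close>

text \<open>Started from the law of layer \<open>k\<close>, the chain has the law of layer
  \<open>k + i\<close> after \<open>i\<close> steps; expectation is linear.\<close>

lemma sum_layer_visits:
  "(\<Sum>\<eta>\<in>layer k. layer_law \<eta> * visits \<A> n \<eta>) =
   (\<Sum>i<n. \<Sum>\<eta>\<in>layer (k + i). layer_law \<eta> * indicator \<A> \<eta>)"
proof (induction n arbitrary: k)
  case (Suc n)
  show ?case
    unfolding sum.lessThan_Suc_shift
    by (simp add: distrib_left sum.distrib sum_layer_step Suc.IH)
qed simp

text \<open>The chain only grows, so all later states contain \<open>\<eta>\<close>.\<close>

lemma visits_eq_0:
  assumes "\<And>\<eta>'. \<lbrakk>\<eta>' \<in> \<A>; \<eta> \<subseteq> \<eta>'\<rbrakk> \<Longrightarrow> False"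
  shows "visits \<A> n \<eta> = 0"
  using assms
proof (induction n arbitrary: \<eta>)
  case (Suc n)
  have "visits \<A> n (insert j \<eta>) = 0" for j
    by (rule Suc.IH) (use Suc.prems in blast)
  moreover have "\<eta> \<notin> \<A>"
    using Suc.prems by blast
  ultimately show ?case by simp
qed simp

section \<open>Lower bounds for the transition probabilities\<close>

text \<open>The transposition fixes \<open>\<zeta>\<close> if \<open>j\<close> lies in it; otherwise
  it replaces \<open>i\<close> by \<open>j\<close>, which multiplies the weight by
  \<open>r j / r i\<close>.\<close>

lemma layer_law_transpose:
  assumes "i \<in> U" "j \<in> U" "i \<in> \<zeta>" "\<zeta> \<subseteq> U" and c: "c \<le> 1" "c * r i \<le> r j"
  shows "c * layer_law \<zeta> \<le> layer_law (Transposition.transpose i j ` \<zeta>)"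
proof (cases "j \<in> \<zeta>")
  case True
  then have "Transposition.transpose i j ` \<zeta> = \<zeta>"
    using assms(3) by (simp add: transpose_image_eq)
  then show ?thesis
    using mult_right_mono[OF c(1) layer_law_nonneg[OF assms(4)]] by simp
next
  case False
  have fin: "finite \<zeta>"
    using assms(4) by (rule finite_subset) simp
  have img: "Transposition.transpose i j ` \<zeta> = insert j (\<zeta> - {i})"
    using False assms(3) by (auto simp: Transposition.transpose_def image_iff)
  have crd: "card (insert j (\<zeta> - {i})) = card \<zeta>"
    using fin False assms(3) card_Suc_Diff1[OF fin assms(3)] by (simp del: card_Diff_singleton)
  have "0 \<le> prod r (\<zeta> - {i})" "0 \<le> layer_weight (card \<zeta>)"
    using assms(4) unfolding layer_weight_def
    by (auto intro!: less_imp_le[OF prod_r_pos] sum_nonneg dest: layerD)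
  moreover have "prod r \<zeta> = r i * prod r (\<zeta> - {i})"
    using prod.remove[OF fin assms(3)] .
  moreover have "prod r (insert j (\<zeta> - {i})) = r j * prod r (\<zeta> - {i})"
    using fin False by simp
  ultimately show ?thesis
    unfolding img layer_law_def crd
    using mult_right_mono[OF c(2), of "prod r (\<zeta> - {i}) / layer_weight (card \<zeta>)"]
    by (simp add: mult.assoc)
qed

text \<open>Transposing \<open>i\<close> and \<open>j\<close> fixes \<open>\<eta>\<close>, maps the
  sets \<open>\<zeta>\<close> containing \<open>i\<close> onto those containing \<open>j\<close>,
  and preserves the size of \<open>\<zeta> - \<eta>\<close>.\<close>

lemma step_comparison:
  assumes \<eta>: "\<eta> \<subseteq> U" and ij: "i \<in> U - \<eta>" "j \<in> U - \<eta>" and c: "c \<le> 1" "c * r i \<le> r j"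
  shows "c * step \<eta> i \<le> step \<eta> j"
proof -
  let ?t = "\<lambda>\<zeta>. Transposition.transpose i j ` \<zeta>"
  let ?L = "layer (Suc (card \<eta>))"
  have invol: "?t (?t \<zeta>) = \<zeta>" for \<zeta>
    by (simp add: image_image)
  have tL: "?t \<zeta> \<in> ?L" if "\<zeta> \<in> ?L" for \<zeta>
    unfolding layer_def
  proof (intro CollectI conjI)
    show "?t \<zeta> \<subseteq> U"
      using layerD(1)[OF that] ij by (auto simp: Transposition.transpose_def)
    show "card (?t \<zeta>) = Suc (card \<eta>)"
      using layerD(2)[OF that] by (simp add: card_image)
  qed
  have t_\<eta>: "?t \<eta> = \<eta>"
    using ij by (intro transpose_image_eq) auto
  have card_t: "card (?t \<zeta> - \<eta>) = card (\<zeta> - \<eta>)" for \<zeta>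
  proof -
    have "?t (\<zeta> - \<eta>) = ?t \<zeta> - \<eta>"
      using image_set_diff[OF inj_transpose[of i j], of \<zeta> \<eta>] by (simp add: t_\<eta>)
    then show ?thesis
      by (metis card_image inj_on_subset inj_transpose subset_UNIV)
  qed
  have "c * step \<eta> i = (\<Sum>\<zeta>\<in>{\<zeta>\<in>?L. i \<in> \<zeta>}. c * layer_law \<zeta> / card (\<zeta> - \<eta>))"
    by (simp add: step_def sum_distrib_left)
  also have "\<dots> \<le> (\<Sum>\<zeta>\<in>{\<zeta>\<in>?L. i \<in> \<zeta>}. layer_law (?t \<zeta>) / card (?t \<zeta> - \<eta>))"
    unfolding card_t using ij c
    by (intro sum_mono divide_right_mono layer_law_transpose) (auto dest: layerD)
  also have "\<dots> = step \<eta> j"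
    unfolding step_def
  proof (rule sum.reindex_bij_witness[of _ ?t ?t])
    fix \<zeta> assume "\<zeta> \<in> {\<zeta>\<in>?L. i \<in> \<zeta>}"
    then show "?t \<zeta> \<in> {\<zeta>\<in>?L. j \<in> \<zeta>}"
      using tL by (auto intro!: image_eqI[of _ _ i])
  next
    fix \<zeta> assume "\<zeta> \<in> {\<zeta>\<in>?L. j \<in> \<zeta>}"
    then show "?t \<zeta> \<in> {\<zeta>\<in>?L. i \<in> \<zeta>}"
      using tL by (auto intro!: image_eqI[of _ _ j])
  qed (simp_all add: invol)
  finally show ?thesis .
qed

text \<open>Averaging the comparison over all \<open>i\<close> in \<open>U - \<eta>\<close>, where
  the steps sum to 1.\<close>

lemma step_ge:
  assumes "\<eta> \<subseteq> U" and j: "j \<in> U - \<eta>"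
    and c: "c \<le> 1" "\<And>i. i \<in> U \<Longrightarrow> c * r i \<le> r j"
  shows "c / card (U - \<eta>) \<le> step \<eta> j"
proof -
  have "0 < card (U - \<eta>)"
    using j by (auto simp: card_gt_0_iff)
  have "c = (\<Sum>i\<in>U - \<eta>. c * step \<eta> i)"
    using sum_step[of \<eta>] assms by (auto simp: sum_distrib_left[symmetric])
  also have "\<dots> \<le> (\<Sum>i\<in>U - \<eta>. step \<eta> j)"
    using assms by (intro sum_mono step_comparison) auto
  also have "\<dots> = card (U - \<eta>) * step \<eta> j"
    by simp
  finally show ?thesis
    using \<open>0 < card (U - \<eta>)\<close> by (simp add: field_simps)
qed

section \<open>Sperner families along the chain\<close>

text \<open>\<open>K = 1 / (\<kappa> * c)\<close> solves
  \<open>K = 1 + (1 - \<kappa> * c) * K\<close>: a visit counts 1, and at least the fraction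
  \<open>\<kappa> * c\<close> of the mass then enters \<open>B \<eta>\<close> and contributes
  nothing more.\<close>

lemma visits_le:
  fixes \<kappa> :: real
  assumes B: "\<And>\<eta>. \<eta> \<in> \<A> \<Longrightarrow> B \<eta> \<subseteq> U - \<eta>"
      "\<And>\<eta>. \<eta> \<in> \<A> \<Longrightarrow> \<kappa> * card (U - \<eta>) \<le> card (B \<eta>)"
      "\<And>\<eta> \<eta>'. \<lbrakk>\<eta> \<in> \<A>; \<eta>' \<in> \<A>; \<eta> \<subseteq> \<eta>'\<rbrakk> \<Longrightarrow> \<eta>' \<inter> B \<eta> = {}"
    and \<kappa>: "0 < \<kappa>" "\<kappa> \<le> 1"
    and c: "0 < c" "c \<le> 1" "\<And>i j. \<lbrakk>i \<in> U; j \<in> U\<rbrakk> \<Longrightarrow> c * r i \<le> r j"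
    and "\<eta> \<subseteq> U"
  shows "visits \<A> n \<eta> \<le> 1 / (\<kappa> * c)"
  using \<open>\<eta> \<subseteq> U\<close>
proof (induction n arbitrary: \<eta>)
  case 0
  then show ?case using \<kappa> c by simp
next
  case (Suc n)
  let ?K = "1 / (\<kappa> * c)"
  \<comment> \<open>The bound by 1 settles \<open>\<eta> = U\<close>, where at most one visit
    remains.\<close>
  have K: "1 \<le> ?K" "0 \<le> ?K"
    using \<kappa> c by (simp_all add: mult_le_one)
  have IH: "visits \<A> n (insert j \<eta>) \<le> ?K" if "j \<in> U - \<eta>" for j
    using Suc.IH[of "insert j \<eta>"] Suc.prems that by auto
  show ?case
  proof (cases "\<eta> = U")
    case True
    then show ?thesis using K by (simp add: indicator_def)
  next
    case False
    then have sub: "\<eta> \<subset> U" using Suc.prems by auto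
    then have pos: "0 < card (U - \<eta>)" by (auto simp: card_gt_0_iff)
    show ?thesis
    proof (cases "\<eta> \<in> \<A>")
      case False
      have "(\<Sum>j\<in>U - \<eta>. step \<eta> j * visits \<A> n (insert j \<eta>)) \<le> (\<Sum>j\<in>U - \<eta>. step \<eta> j * ?K)"
        using IH step_nonneg by (intro sum_mono mult_left_mono) auto
      also have "\<dots> = ?K"
        by (simp only: sum_distrib_right[symmetric] sum_step[OF sub] mult_1)
      finally show ?thesis using False by simp
    next
      case True
      have "\<kappa> * c \<le> c / card (U - \<eta>) * card (B \<eta>)"
        using mult_left_mono[OF B(2)[OF True], of c] c(1) pos by (simp add: field_simps)
      also have "\<dots> \<le> (\<Sum>j\<in>B \<eta>. step \<eta> j)"
        using B(1)[OF True] Suc.prems c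
          sum_mono[of "B \<eta>" "\<lambda>_. c / card (U - \<eta>)" "step \<eta>"] step_ge[of \<eta> _ c]
        by (auto simp: subset_iff mult.commute)
      finally have enter_B: "\<kappa> * c \<le> (\<Sum>j\<in>B \<eta>. step \<eta> j)" .
      have split: "(\<Sum>j\<in>U - \<eta>. f j) = (\<Sum>j\<in>U - \<eta> - B \<eta>. f j) + (\<Sum>j\<in>B \<eta>. f j)"
        for f :: "'a \<Rightarrow> real"
        using B(1)[OF True] by (intro sum.subset_diff) auto
      \<comment> \<open>A member of \<open>\<A>\<close> above \<open>insert j \<eta>\<close> would
        contain \<open>\<eta>\<close> and meet \<open>B \<eta>\<close> in \<open>j\<close>.\<close>
      have dead: "visits \<A> n (insert j \<eta>) = 0" if "j \<in> B \<eta>" for j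
        by (rule visits_eq_0) (use B(3)[OF True] that in blast)
      have "(\<Sum>j\<in>U - \<eta>. step \<eta> j * visits \<A> n (insert j \<eta>)) =
          (\<Sum>j\<in>U - \<eta> - B \<eta>. step \<eta> j * visits \<A> n (insert j \<eta>))"
        using dead by (simp add: split)
      also have "\<dots> \<le> (\<Sum>j\<in>U - \<eta> - B \<eta>. step \<eta> j * ?K)"
        using IH step_nonneg by (intro sum_mono mult_left_mono) auto
      also have "\<dots> = (1 - (\<Sum>j\<in>B \<eta>. step \<eta> j)) * ?K"
        using sum_step[OF sub] split[of "step \<eta>"]
        by (simp only: sum_distrib_right[symmetric] eq_diff_eq[symmetric])
      also have "\<dots> \<le> (1 - \<kappa> * c) * ?K"
        using enter_B K by (intro mult_right_mono) auto
      also have "\<dots> = ?K - 1"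
        using \<kappa> c by (simp add: field_simps)
      finally show ?thesis using True by simp
    qed
  qed
qed

text \<open>Layer 0 consists of the empty set alone, so the sum is the expected number of visits
  from that deterministic start.\<close>

lemma sum_layer_law_Sperner_le:
  fixes \<kappa> :: real
  assumes B: "\<And>\<eta>. \<eta> \<in> \<A> \<Longrightarrow> B \<eta> \<subseteq> U - \<eta>"
      "\<And>\<eta>. \<eta> \<in> \<A> \<Longrightarrow> \<kappa> * card (U - \<eta>) \<le> card (B \<eta>)"
      "\<And>\<eta> \<eta>'. \<lbrakk>\<eta> \<in> \<A>; \<eta>' \<in> \<A>; \<eta> \<subseteq> \<eta>'\<rbrakk> \<Longrightarrow> \<eta>' \<inter> B \<eta> = {}"
    and \<kappa>: "0 < \<kappa>" "\<kappa> \<le> 1"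
    and c: "0 < c" "c \<le> 1" "\<And>i j. \<lbrakk>i \<in> U; j \<in> U\<rbrakk> \<Longrightarrow> c * r i \<le> r j"
  shows "(\<Sum>k<n. \<Sum>\<eta>\<in>layer k \<inter> \<A>. layer_law \<eta>) \<le> 1 / (\<kappa> * c)"
proof -
  have "layer 0 = {{}}"
    using finite_subset[OF _ finite_U] by (auto simp: layer_def)
  moreover have "layer_law {} = 1"
    using calculation by (simp add: layer_law_def layer_weight_def)
  moreover have "(\<Sum>\<eta>\<in>layer k. layer_law \<eta> * indicator \<A> \<eta>) = (\<Sum>\<eta>\<in>layer k \<inter> \<A>. layer_law \<eta>)" for k
    by (simp add: sum.inter_restrict indicator_def if_distrib cong: if_cong)
  ultimately have "(\<Sum>k<n. \<Sum>\<eta>\<in>layer k \<inter> \<A>. layer_law \<eta>) = visits \<A> n {}"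
    using sum_layer_visits[of \<A> n 0] by simp
  also have "\<dots> \<le> 1 / (\<kappa> * c)"
    by (rule visits_le[of \<A> B]) (use assms in auto)
  finally show ?thesis .
qed

end

section \<open>Product distributions conditioned on cardinality\<close>

text \<open>The singleton is the intersection of the independent events that coordinate
  \<open>k\<close> agrees with \<open>S\<close>; \<open>1 \<le> N\<close> keeps this intersection
  nonempty-indexed.\<close>

lemma product_distribution_prob_singleton:
  assumes "product_distribution N \<mu>" "S \<subseteq> {1..N}" "1 \<le> N"
  shows "measure \<mu> {S} = (\<Prod>k\<in>{1..N}. if k \<in> S then marginal \<mu> k else 1 - marginal \<mu> k)"
proof -
  interpret prob_space \<mu>
    using assms by (simp add: product_distribution_def)
  have sp: "space \<mu> = Pow {1..N}" and st: "sets \<mu> = Pow (Pow {1..N})"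
    and ind: "indep_vars (\<lambda>_. count_space UNIV) (\<lambda>k S. k \<in> S) {1..N}"
    using assms by (auto simp: product_distribution_def)
  let ?E = "\<lambda>k. (\<lambda>T. k \<in> T) -` {k \<in> S} \<inter> space \<mu>"
  have "{S} = (\<Inter>k\<in>{1..N}. ?E k)"
  proof (intro equalityI subsetI)
    fix T assume T: "T \<in> (\<Inter>k\<in>{1..N}. ?E k)"
    then have "T \<subseteq> {1..N}"
      using sp assms(3) by force
    moreover have "k \<in> T \<longleftrightarrow> k \<in> S" if "k \<in> {1..N}" for k
      using T that by auto
    ultimately show "T \<in> {S}"
      using assms(2) by blast
  qed (use assms sp in auto)
  then have "prob {S} = prob (\<Inter>k\<in>{1..N}. ?E k)"
    by (rule arg_cong)
  also have "\<dots> = (\<Prod>k\<in>{1..N}. prob (?E k))"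
    using assms(3) by (intro indep_varsD[OF ind]) auto
  also have "\<dots> = (\<Prod>k\<in>{1..N}. if k \<in> S then marginal \<mu> k else 1 - marginal \<mu> k)"
  proof (intro prod.cong refl)
    fix k
    have "prob {T \<in> space \<mu>. \<not> k \<in> T} = 1 - marginal \<mu> k"
      unfolding marginal_def by (intro prob_neg) (auto simp: sp st)
    then show "prob (?E k) = (if k \<in> S then marginal \<mu> k else 1 - marginal \<mu> k)"
      by (simp add: marginal_def vimage_def Int_def conj_commute)
  qed
  finally show ?thesis .
qed

theorem lemma4p11:
  fixes N :: nat and M :: "'a measure" and \<xi> :: "'a \<Rightarrow> nat set" and \<mu> :: "nat set measure"
    and \<beta> \<kappa> :: real and \<A> :: "nat set set"
  assumes "N \<ge> 1"
    and "prob_space M"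
    and "\<xi> \<in> measurable M (count_space (Pow {1..N}))"
    and "distr M (count_space (Pow {1..N})) \<xi> = \<mu>"
    and "nontrivial_product_distribution N \<mu>"
    and "0 < \<beta>"
    and "\<And>k. k \<in> {1..N} \<Longrightarrow> \<beta> \<le> min (marginal \<mu> k) (1 - marginal \<mu> k)"
    and "0 < \<kappa>" and "\<kappa> \<le> 1"
    and "Sperner_family N \<kappa> \<A>"
  shows "(\<Sum>k = 0..N. \<P>(\<omega> in M. \<xi> \<omega> \<in> \<A> \<bar> card (\<xi> \<omega>) = k)) \<le> (1 - \<beta>)\<^sup>2 / (\<beta>\<^sup>2 * \<kappa>)"
proof -
  interpret prob_space M by fact
  define p where "p = marginal \<mu>"
  define r where "r k = p k / (1 - p k)" for k
  \<comment> \<open>All \<open>r k\<close> lie between \<open>\<beta> / (1 - \<beta>)\<close> and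
    its inverse; \<open>c\<close> is the quotient of these bounds.\<close>
  define c where "c = (\<beta> / (1 - \<beta>))\<^sup>2"
  have p: "0 < p k" "p k < 1" "\<beta> \<le> p k" "p k \<le> 1 - \<beta>" if "k \<in> {1..N}" for k
    using assms(5,7) that by (force simp: nontrivial_product_distribution_def p_def)+
  have prodd: "product_distribution N \<mu>"
    using assms(5) by (simp add: nontrivial_product_distribution_def)
  \<comment> \<open>Coordinate 1 exists as \<open>N \<ge> 1\<close>; the inequality gives
    \<open>c \<le> 1\<close>.\<close>
  have \<beta>: "\<beta> \<le> 1 - \<beta>"
    using p(3,4)[of 1] assms(1) by simp
  interpret weighted_subsets "{1..N}" r
    by unfold_locales (use p in \<open>auto simp: r_def\<close>)
  have c: "0 < c" "c \<le> 1"
    using \<beta> assms(6) by (auto simp: c_def power_le_one)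
  have cr: "c * r i \<le> r j" if "i \<in> {1..N}" "j \<in> {1..N}" for i j
  proof -
    have "r i \<le> (1 - \<beta>) / \<beta>"
      using p[OF that(1)] assms(6) \<beta> unfolding r_def by (intro frac_le) auto
    then have "c * r i \<le> c * ((1 - \<beta>) / \<beta>)"
      using c by (intro mult_left_mono) auto
    also have "\<dots> = \<beta> / (1 - \<beta>)"
      using \<beta> assms(6) by (simp add: c_def power2_eq_square)
    also have "\<dots> \<le> r j"
      using p[OF that(2)] assms(6) \<beta> unfolding r_def by (intro frac_le) auto
    finally show ?thesis .
  qed
  \<comment> \<open>The probability of the empty set; it cancels in the conditional
    probabilities.\<close>
  define Z where "Z = (\<Prod>k\<in>{1..N}. 1 - p k)"
  have Z: "0 < Z"
    unfolding Z_def using p by (intro prod_pos) simp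
  have single: "measure \<mu> {S} = Z * prod r S" if "S \<subseteq> {1..N}" for S
  proof -
    have "measure \<mu> {S} = (\<Prod>k\<in>{1..N}. (1 - p k) * (if k \<in> S then r k else 1))"
      unfolding product_distribution_prob_singleton[OF prodd that assms(1)]
      using p by (intro prod.cong) (force simp: r_def p_def)+
    also have "\<dots> = Z * (\<Prod>k\<in>{1..N}. if k \<in> S then r k else 1)"
      by (simp add: prod.distrib Z_def)
    also have "(\<Prod>k\<in>{1..N}. if k \<in> S then r k else 1) = prod r ({1..N} \<inter> S)"
      by (rule prod.inter_restrict[symmetric]) simp
    also have "{1..N} \<inter> S = S" using that by auto
    finally show ?thesis .
  qed
  have prob_in: "prob {\<omega>\<in>space M. \<xi> \<omega> \<in> \<S>} = Z * (\<Sum>S\<in>\<S>. prod r S)" if "\<S> \<subseteq> Pow {1..N}" for \<S>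
  proof -
    have "prob {\<omega>\<in>space M. \<xi> \<omega> \<in> \<S>} = measure \<mu> \<S>"
      unfolding assms(4)[symmetric] using assms(3) that
      by (subst measure_distr) (auto intro!: arg_cong[where f = prob])
    also have "\<dots> = (\<Sum>S\<in>\<S>. measure \<mu> {S})"
    proof -
      interpret \<mu>: prob_space \<mu> using prodd by (simp add: product_distribution_def)
      have "finite \<S>" using that by (rule finite_subset) simp
      moreover have "sets \<mu> = Pow (Pow {1..N})"
        using prodd by (simp add: product_distribution_def)
      ultimately show ?thesis
        using that by (intro \<mu>.finite_measure_eq_sum_singleton) auto
    qed
    also have "\<dots> = Z * (\<Sum>S\<in>\<S>. prod r S)"
      using that single by (auto simp: sum_distrib_left intro!: sum.cong)
    finally show ?thesis .
  qed
  have \<xi>_sub: "\<xi> \<omega> \<subseteq> {1..N}" if "\<omega> \<in> space M" for \<omega>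
    using measurable_space[OF assms(3) that] by simp
  have cond: "\<P>(\<omega> in M. \<xi> \<omega> \<in> \<A> \<bar> card (\<xi> \<omega>) = k) = (\<Sum>S\<in>layer k \<inter> \<A>. layer_law S)" for k
  proof -
    have "\<xi> \<omega> \<in> layer k \<longleftrightarrow> card (\<xi> \<omega>) = k" if "\<omega> \<in> space M" for \<omega>
      using \<xi>_sub[OF that] unfolding layer_def by simp
    then have events: "{\<omega>\<in>space M. card (\<xi> \<omega>) = k} = {\<omega>\<in>space M. \<xi> \<omega> \<in> layer k}"
      "{\<omega>\<in>space M. \<xi> \<omega> \<in> \<A> \<and> card (\<xi> \<omega>) = k} = {\<omega>\<in>space M. \<xi> \<omega> \<in> layer k \<inter> \<A>}"
      by auto
    have sub: "layer k \<subseteq> Pow {1..N}" "layer k \<inter> \<A> \<subseteq> Pow {1..N}"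
      using layerD(1) by blast+
    have "\<P>(\<omega> in M. \<xi> \<omega> \<in> \<A> \<bar> card (\<xi> \<omega>) = k) =
        Z * (\<Sum>S\<in>layer k \<inter> \<A>. prod r S) / (Z * layer_weight k)"
      by (simp only: cond_prob_def layer_weight_def events prob_in[OF sub(1)] prob_in[OF sub(2)])
    also have "\<dots> = (\<Sum>S\<in>layer k \<inter> \<A>. prod r S / layer_weight k)"
      using Z by (simp add: sum_divide_distrib)
    also have "\<dots> = (\<Sum>S\<in>layer k \<inter> \<A>. layer_law S)"
      by (intro sum.cong refl) (metis IntD1 layerD(2) layer_law_def)
    finally show ?thesis .
  qed
  obtain B where B: "\<And>\<eta>. \<eta> \<in> \<A> \<Longrightarrow> B \<eta> \<subseteq> {1..N} - \<eta> \<and>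
      \<kappa> * real (card ({1..N} - \<eta>)) \<le> real (card (B \<eta>)) \<and>
      (\<forall>\<eta>'\<in>\<A>. \<eta> \<subseteq> \<eta>' \<longrightarrow> \<eta>' \<inter> B \<eta> = {})"
    using assms(10) unfolding Sperner_family_def by metis
  have "(\<Sum>k = 0..N. \<P>(\<omega> in M. \<xi> \<omega> \<in> \<A> \<bar> card (\<xi> \<omega>) = k)) =
      (\<Sum>k<Suc N. \<Sum>S\<in>layer k \<inter> \<A>. layer_law S)"
    by (simp only: cond atLeast0AtMost lessThan_Suc_atMost)
  also have "\<dots> \<le> 1 / (\<kappa> * c)"
    by (rule sum_layer_law_Sperner_le[of \<A> B]) (use B assms(8,9) c cr in auto)
  also have "\<dots> = (1 - \<beta>)\<^sup>2 / (\<beta>\<^sup>2 * \<kappa>)"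
    by (simp add: c_def power_divide mult.commute)
  finally show ?thesis .
qed

end
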